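(* Let $\mathscr{H}$ be a nonzero complex Hilbert space and let $T\in \mathbb{B}(\mathscr{H})$. Then the following statements are equivalent: (i) $T\parallel I$; (ii) $T\parallel T^*$; (iii) there exist a sequence of unit vectors $\{\xi_n\}$ in $\mathscr{H}$ and $\lambda\in\mathbb{T}$ such that $\lim_{n\rightarrow\infty} \big\|T\xi_n-\lambda\|T\|\xi_n\big\|=0$; (iv) $T^m\parallel I$ for all $m\in\mathbb{N}$; (v) $T^m\parallel (T^* )^m$ for all $m\in\mathbb{N}$.
   Context: $\mathbb{B}(\mathscr{H})$ is the $C^*$-algebra of bounded linear operators on $\mathscr{H}$ with the operator norm; $I$ is the identity operator on $\mathscr{H}$; $\mathbb{N}=\{1,2,3,\dots\}$; $\mathbb{T}=\{\alpha\in\mathbb{C}:|\alpha|=1\}$. For elements $x,y$ of a normed space, $x\parallel y$ ($x$ is parallel to $y$) means that $\|x+\lambda y\|=\|x\|+\|y\|$ for some $\lambda\in\mathbb{T}$; here this is used in $\mathbb{B}(\mathscr{H})$ with the operator norm. *)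

theory Defs
  imports "HOL-Analysis.Analysis"
begin

section \<open>Complex Hilbert spaces\<close>

class complex_vector = real_vector +
  fixes scaleC :: "complex \<Rightarrow> 'a \<Rightarrow> 'a" (infixr \<open>*\<^sub>C\<close> 75)
  assumes scaleC_add_right: "a *\<^sub>C (x + y) = a *\<^sub>C x + a *\<^sub>C y"
    and scaleC_add_left: "(a + b) *\<^sub>C x = a *\<^sub>C x + b *\<^sub>C x"
    and scaleC_scaleC: "a *\<^sub>C b *\<^sub>C x = (a * b) *\<^sub>C x"
    and scaleC_one: "1 *\<^sub>C x = x"
    and scaleR_scaleC: "r *\<^sub>R x = complex_of_real r *\<^sub>C x"

class complex_normed_vector = complex_vector + real_normed_vector +
  assumes norm_scaleC: "norm (a *\<^sub>C x) = cmod a * norm x"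

(* The inner product is linear in its first argument. *)
class complex_inner = complex_normed_vector +
  fixes cinner :: "'a \<Rightarrow> 'a \<Rightarrow> complex"
  assumes cinner_commute: "cinner x y = cnj (cinner y x)"
    and cinner_add_left: "cinner (x + y) z = cinner x z + cinner y z"
    and cinner_scaleC_left: "cinner (a *\<^sub>C x) y = a * cinner x y"
    and cinner_ge_zero: "0 \<le> Re (cinner x x)"
    and cinner_eq_zero_iff: "cinner x x = 0 \<longleftrightarrow> x = 0"
    and norm_eq_sqrt_cinner: "norm x = sqrt (Re (cinner x x))"

class chilbert_space = complex_inner + complete_space

instantiation complex :: chilbert_space
begin
definition "scaleC_complex a (x :: complex) = a * x"
definition "cinner_complex (x :: complex) y = x * cnj y"
instance
proof
  fix x y z a b :: complex and r :: real
  show "a *\<^sub>C (x + y) = a *\<^sub>C x + a *\<^sub>C y" "(a + b) *\<^sub>C x = a *\<^sub>C x + b *\<^sub>C x"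
    "a *\<^sub>C b *\<^sub>C x = (a * b) *\<^sub>C x" "1 *\<^sub>C x = x" "r *\<^sub>R x = complex_of_real r *\<^sub>C x"
    "norm (a *\<^sub>C x) = cmod a * norm x"
    by (simp_all add: scaleC_complex_def algebra_simps norm_mult scaleR_conv_of_real)
  show "cinner x y = cnj (cinner y x)" "cinner (x + y) z = cinner x z + cinner y z"
    "cinner (a *\<^sub>C x) y = a * cinner x y" "0 \<le> Re (cinner x x)" "cinner x x = 0 \<longleftrightarrow> x = 0"
    "norm x = sqrt (Re (cinner x x))"
    by (simp_all add: scaleC_complex_def cinner_complex_def algebra_simps cmod_def power2_eq_square)
qed

end

lemma scaleC_zero_left [simp]: "0 *\<^sub>C (x :: 'a :: complex_vector) = 0"
  using scaleR_scaleC[of 0 x] by simp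

lemma scaleC_minus_one: "(- 1) *\<^sub>C (x :: 'a :: complex_vector) = - x"
  using scaleR_scaleC[of "- 1" x] by simp

lemma scaleC_diff_right: "a *\<^sub>C (x - y :: 'a :: complex_vector) = a *\<^sub>C x - a *\<^sub>C y"
  using scaleC_add_right[of a "x - y" y] by (simp add: algebra_simps)

lemma scaleC_zero_right [simp]: "a *\<^sub>C (0 :: 'a :: complex_vector) = 0"
  using scaleC_diff_right[of a 0 "0 :: 'a"] by simp

lemma scaleC_minus_right: "a *\<^sub>C (- x :: 'a :: complex_vector) = - (a *\<^sub>C x)"
  using scaleC_diff_right[of a 0 x] by simp

lemma scaleC_scaleR: "a *\<^sub>C r *\<^sub>R (x :: 'a :: complex_vector) = r *\<^sub>R a *\<^sub>C x"
  by (simp add: scaleR_scaleC scaleC_scaleC mult.commute)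

section \<open>Parallelism\<close>

definition parallel :: "'a :: complex_normed_vector \<Rightarrow> 'a \<Rightarrow> bool" (infix \<open>\<parallel>\<close> 50) where
  "x \<parallel> y \<longleftrightarrow> (\<exists>\<alpha>::complex. cmod \<alpha> = 1 \<and> norm (x + \<alpha> *\<^sub>C y) = norm x + norm y)"

section \<open>The algebra of bounded linear operators\<close>

(* The library type of bounded operators is real-linear, so the complex-linear ones are carved out
   as a subtype, which inherits the operator norm. *)
typedef (overloaded) 'a bop =
  "{A :: 'a::complex_normed_vector \<Rightarrow>\<^sub>L 'a. \<forall>c x. A (c *\<^sub>C x) = c *\<^sub>C A x}"
  morphisms blinfun_of_bop Bop
  by (rule exI[of _ id_blinfun]) simp

setup_lifting type_definition_bop

lift_definition bop_apply :: "'a::complex_normed_vector bop \<Rightarrow> 'a \<Rightarrow> 'a" is blinfun_apply .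

declare [[coercion bop_apply]]

lemma bop_eqI: "(\<And>x. bop_apply A x = bop_apply B x) \<Longrightarrow> A = B"
  by transfer (rule blinfun_eqI)

lemma bop_apply_scaleC: "bop_apply A (c *\<^sub>C x) = c *\<^sub>C bop_apply A x"
  by transfer simp

lemma bounded_linear_bop_apply: "bounded_linear (bop_apply A)"
  by transfer (rule blinfun.bounded_linear_right)

instantiation bop :: (complex_normed_vector) complex_normed_vector
begin

lift_definition zero_bop :: "'a bop" is 0
  by simp
lift_definition plus_bop :: "'a bop \<Rightarrow> 'a bop \<Rightarrow> 'a bop" is "(+)"
  by (simp add: blinfun.add_left scaleC_add_right)
lift_definition uminus_bop :: "'a bop \<Rightarrow> 'a bop" is uminus
  by (simp add: blinfun.minus_left scaleC_minus_right)
lift_definition minus_bop :: "'a bop \<Rightarrow> 'a bop \<Rightarrow> 'a bop" is "(-)"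
  by (simp add: blinfun.diff_left scaleC_diff_right)
lift_definition scaleR_bop :: "real \<Rightarrow> 'a bop \<Rightarrow> 'a bop" is scaleR
  by (simp add: blinfun.scaleR_left scaleC_scaleR)

lemma bounded_linear_scaleC: "bounded_linear (\<lambda>x :: 'a. c *\<^sub>C x)"
  by (rule bounded_linear_intro[where K = "cmod c"])
    (simp_all add: scaleC_add_right scaleC_scaleR norm_scaleC mult.commute)

lift_definition scaleC_bop :: "complex \<Rightarrow> 'a bop \<Rightarrow> 'a bop" is
  "\<lambda>c (A :: 'a \<Rightarrow>\<^sub>L 'a). Blinfun (\<lambda>x. c *\<^sub>C A x) :: 'a \<Rightarrow>\<^sub>L 'a"
  by (simp add: bounded_linear_Blinfun_apply bounded_linear_compose[OF bounded_linear_scaleC]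
      blinfun.bounded_linear_right scaleC_scaleC mult.commute)

lift_definition norm_bop :: "'a bop \<Rightarrow> real" is norm .
lift_definition dist_bop :: "'a bop \<Rightarrow> 'a bop \<Rightarrow> real" is dist .
definition sgn_bop :: "'a bop \<Rightarrow> 'a bop" where "sgn_bop A = scaleR (inverse (norm A)) A"
definition uniformity_bop :: "('a bop \<times> 'a bop) filter" where
  "uniformity_bop = (INF e\<in>{0<..}. principal {(A, B). dist A B < e})"
definition open_bop :: "'a bop set \<Rightarrow> bool" where
  "open_bop S = (\<forall>A\<in>S. \<forall>\<^sub>F (A', B) in uniformity. A' = A \<longrightarrow> B \<in> S)"

lemma bop_apply_scaleC_left: "bop_apply (c *\<^sub>C A) x = c *\<^sub>C bop_apply A x"
  by transfer (simp add: bounded_linear_Blinfun_apply blinfun.bounded_linear_right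
      bounded_linear_compose[OF bounded_linear_scaleC])

lemma bop_apply_add_left: "bop_apply (A + B) x = bop_apply A x + bop_apply B x"
  by transfer (rule blinfun.add_left)

lemma bop_apply_scaleR_left: "bop_apply (r *\<^sub>R A) x = r *\<^sub>R bop_apply A x"
  by transfer (rule blinfun.scaleR_left)

lemma norm_bop_le: "norm (bop_apply A x) \<le> norm A * norm x"
  by transfer (rule norm_blinfun)

lemma norm_bop_bound: "0 \<le> b \<Longrightarrow> (\<And>x. norm (bop_apply A x) \<le> b * norm x) \<Longrightarrow> norm A \<le> b"
  by transfer (rule norm_blinfun_bound)

lemma norm_bop_ge_zero: "0 \<le> norm (A :: 'a bop)"
  by transfer simp

lemma norm_scaleC_bop_le: "norm (c *\<^sub>C A) \<le> cmod c * norm (A :: 'a bop)"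
  by (rule norm_bop_bound)
    (simp_all add: bop_apply_scaleC_left norm_scaleC norm_bop_ge_zero mult.assoc
      mult_left_mono norm_bop_le)

instance
proof
  fix A B C :: "'a bop" and r s :: real and a b :: complex and S :: "'a bop set"
  show "A + B + C = A + (B + C)" by transfer simp
  show "A + B = B + A" by transfer simp
  show "0 + A = A" by transfer simp
  show "- A + A = 0" by transfer simp
  show "A - B = A + - B" by transfer simp
  show "r *\<^sub>R (A + B) = r *\<^sub>R A + r *\<^sub>R B" by transfer (rule scaleR_add_right)
  show "(r + s) *\<^sub>R A = r *\<^sub>R A + s *\<^sub>R A" by transfer (rule scaleR_add_left)
  show "r *\<^sub>R s *\<^sub>R A = (r * s) *\<^sub>R A" by transfer simp
  show "1 *\<^sub>R A = A" by transfer simp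
  show "a *\<^sub>C (A + B) = a *\<^sub>C A + a *\<^sub>C B"
    by (rule bop_eqI) (simp add: bop_apply_scaleC_left bop_apply_add_left scaleC_add_right)
  show "(a + b) *\<^sub>C A = a *\<^sub>C A + b *\<^sub>C A"
    by (rule bop_eqI) (simp add: bop_apply_scaleC_left bop_apply_add_left scaleC_add_left)
  show assoc: "a *\<^sub>C b *\<^sub>C A = (a * b) *\<^sub>C A" for a b
    by (rule bop_eqI) (simp add: bop_apply_scaleC_left scaleC_scaleC)
  show one: "1 *\<^sub>C A = A"
    by (rule bop_eqI) (simp add: bop_apply_scaleC_left scaleC_one)
  show "r *\<^sub>R A = complex_of_real r *\<^sub>C A"
    by (rule bop_eqI) (simp add: bop_apply_scaleC_left bop_apply_scaleR_left scaleR_scaleC)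
  show "dist A B = norm (A - B)" by transfer (rule dist_norm)
  show "sgn A = scaleR (inverse (norm A)) A" by (rule sgn_bop_def)
  show "uniformity = (INF e\<in>{0<..}. principal {(A :: 'a bop, B). dist A B < e})"
    by (rule uniformity_bop_def)
  show "open S = (\<forall>A\<in>S. \<forall>\<^sub>F (A', B) in uniformity. A' = A \<longrightarrow> B \<in> S)"
    by (rule open_bop_def)
  show "norm A = 0 \<longleftrightarrow> A = 0" by transfer simp
  show "norm (A + B) \<le> norm A + norm B" by transfer (rule norm_triangle_ineq)
  show "norm (r *\<^sub>R A) = \<bar>r\<bar> * norm A" by transfer simp
  show "norm (a *\<^sub>C A) = cmod a * norm A"
  proof (cases "a = 0")
    case True
    then show ?thesis
      using norm_scaleC_bop_le[of a A] norm_bop_ge_zero[of "a *\<^sub>C A"] by simp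
  next
    case False
    have "norm (inverse a *\<^sub>C a *\<^sub>C A) \<le> cmod (inverse a) * norm (a *\<^sub>C A)"
      by (rule norm_scaleC_bop_le)
    then have "norm A \<le> inverse (cmod a) * norm (a *\<^sub>C A)"
      using False by (simp only: assoc one norm_inverse left_inverse not_False_eq_True)
    then have "cmod a * norm A \<le> cmod a * (inverse (cmod a) * norm (a *\<^sub>C A))"
      by (rule mult_left_mono) simp
    also have "\<dots> = norm (a *\<^sub>C A)" using False by simp
    finally have "cmod a * norm A \<le> norm (a *\<^sub>C A)" .
    with norm_scaleC_bop_le[of a A] show ?thesis by simp
  qed
qed

end

(* The product is composition, so that 1 is the identity operator and A ^ m the m-fold iterate. *)
instantiation bop :: (complex_normed_vector) monoid_mult
begin

lift_definition one_bop :: "'a bop" is id_blinfun by simp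
lift_definition times_bop :: "'a bop \<Rightarrow> 'a bop \<Rightarrow> 'a bop" is "(o\<^sub>L)" by simp

instance
proof
  fix A B C :: "'a bop"
  show "A * B * C = A * (B * C)" by transfer (auto intro: blinfun_eqI)
  show "1 * A = A" by transfer (auto intro: blinfun_eqI)
  show "A * 1 = A" by transfer (auto intro: blinfun_eqI)
qed

end

lemma bop_apply_one [simp]: "bop_apply 1 x = x"
  by transfer simp

lemma bop_apply_times [simp]: "bop_apply (A * B) x = bop_apply A (bop_apply B x)"
  by transfer simp

section \<open>The adjoint\<close>

definition adj :: "'a::chilbert_space bop \<Rightarrow> 'a bop" (\<open>_\<^sup>\<star>\<close> [1000] 999) where
  "A\<^sup>\<star> = (THE B. \<forall>x y. cinner (bop_apply A x) y = cinner x (bop_apply B y))"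

lemma cinner_add_right: "cinner x (y + z) = cinner x y + cinner x z"
  by (subst (1 2 3) cinner_commute) (simp add: cinner_add_left)

lemma cinner_scaleC_right: "cinner x (a *\<^sub>C y) = cnj a * cinner x y"
  by (subst (1 2) cinner_commute) (simp add: cinner_scaleC_left)

lemma cinner_minus_left: "cinner (- x) y = - cinner x y"
  using cinner_scaleC_left[of "- 1" x y] by (simp add: scaleC_minus_one)

lemma cinner_minus_right: "cinner x (- y) = - cinner x y"
  using cinner_scaleC_right[of x "- 1" y] by (simp add: scaleC_minus_one)

lemma cinner_diff_left: "cinner (x - y) z = cinner x z - cinner y z"
  using cinner_add_left[of x "- y" z] by (simp add: cinner_minus_left)

lemma cinner_diff_right: "cinner x (y - z) = cinner x y - cinner x z"
  using cinner_add_right[of x y "- z"] by (simp add: cinner_minus_right)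

lemma power2_norm_eq_cinner: "(norm x)\<^sup>2 = Re (cinner x x)"
  by (simp add: norm_eq_sqrt_cinner cinner_ge_zero)

lemma power2_norm_add: "(norm (x + y))\<^sup>2 = (norm x)\<^sup>2 + 2 * Re (cinner x y) + (norm y)\<^sup>2"
proof -
  have "Re (cinner y x) = Re (cinner x y)" by (subst cinner_commute) simp
  then show ?thesis by (simp add: power2_norm_eq_cinner cinner_add_left cinner_add_right)
qed

lemma cinner_scaleR_right: "cinner x (r *\<^sub>R y) = complex_of_real r * cinner x y"
  by (simp add: scaleR_scaleC cinner_scaleC_right)

lemma Re_cinner_le: "Re (cinner x y) \<le> norm x * norm y"
proof -
  have "(norm (x + y))\<^sup>2 \<le> (norm x + norm y)\<^sup>2"
    by (intro power_mono norm_triangle_ineq) simp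
  then show ?thesis by (simp add: power2_norm_add power2_sum)
qed

lemma cinner_left_ext:
  assumes "\<And>x. cinner x y = cinner x z" shows "y = z"
proof -
  have "cinner (y - z) (y - z) = 0" using assms[of "y - z"] by (simp add: cinner_diff_right)
  then show ?thesis by (simp add: cinner_eq_zero_iff)
qed

lemma riesz_real:
  fixes f :: "'a::chilbert_space \<Rightarrow> real"
  assumes f: "bounded_linear f"
  shows "\<exists>z. \<forall>h. f h = Re (cinner h z)"
proof -
  interpret f: bounded_linear f by (rule f)
  define J where "J x = (norm x)\<^sup>2 - 2 * f x" for x
  obtain K where K: "\<And>x. \<bar>f x\<bar> \<le> norm x * K" using f.bounded by auto
  have bdd: "- K\<^sup>2 \<le> J x" for x
  proof -
    have "0 \<le> (norm x - K)\<^sup>2" by simp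
    then have "0 \<le> (norm x)\<^sup>2 - 2 * (norm x * K) + K\<^sup>2" by (simp add: power2_diff)
    with K[of x] show ?thesis unfolding J_def by linarith
  qed
  define m where "m = (INF x. J x)"
  have m_le: "m \<le> J x" for x
    unfolding m_def by (rule cINF_lower) (auto intro!: bdd_belowI bdd)
  have bdd_below: "bdd_below (range J)" by (auto intro!: bdd_belowI bdd)
  have "\<exists>x. J x < m + e" if "e > 0" for e
    using cINF_less_iff[of UNIV J "m + e"] that bdd_below by (auto simp: m_def)
  then have "\<exists>x. J x < m + inverse (real (Suc n))" for n by simp
  then obtain X where X: "\<And>n. J (X n) < m + inverse (real (Suc n))" by metis
  have par: "(norm (x - y))\<^sup>2 \<le> 2 * (J x - m) + 2 * (J y - m)" for x y
  proof -
    have 1: "(norm (x + y))\<^sup>2 + (norm (x - y))\<^sup>2 = 2 * (norm x)\<^sup>2 + 2 * (norm y)\<^sup>2"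
      using power2_norm_add[of x y] power2_norm_add[of x "- y"] by (simp add: cinner_minus_right)
    have "4 * J ((1/2) *\<^sub>R (x + y)) = (norm (x + y))\<^sup>2 - 4 * (f x + f y)"
    proof -
      have "(norm ((1/2) *\<^sub>R (x + y)))\<^sup>2 = (norm (x + y))\<^sup>2 / 4"
        by (simp only: norm_scaleR power_mult_distrib) (simp add: power_divide)
      moreover have "f ((1/2) *\<^sub>R (x + y)) = (f x + f y) / 2"
        by (simp only: f.scaleR f.add) simp
      ultimately show ?thesis unfolding J_def by (simp only:) (simp add: field_simps)
    qed
    moreover have "4 * m \<le> 4 * J ((1/2) *\<^sub>R (x + y))"
      by (intro mult_left_mono m_le) simp
    ultimately have "4 * m \<le> (norm (x + y))\<^sup>2 - 4 * (f x + f y)" by (simp only:)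
    with 1 show ?thesis unfolding J_def by argo
  qed
  have "Cauchy X"
  proof (rule metric_CauchyI)
    fix e :: real assume e: "e > 0"
    obtain N where N: "inverse (real (Suc N)) < e\<^sup>2 / 4"
      using reals_Archimedean[of "e\<^sup>2 / 4"] e by auto
    have *: "J (X n) - m < e\<^sup>2 / 4" if "n \<ge> N" for n
    proof -
      have "inverse (real (Suc n)) \<le> inverse (real (Suc N))" using that by (simp add: field_simps)
      with X[of n] N show ?thesis by linarith
    qed
    have "dist (X n) (X k) < e" if "n \<ge> N" "k \<ge> N" for n k
    proof -
      have "(norm (X n - X k))\<^sup>2 < e\<^sup>2" using par[of "X n" "X k"] *[OF that(1)] *[OF that(2)] by argo
      then show ?thesis using e by (simp add: dist_norm power2_less_imp_less)
    qed
    then show "\<exists>M. \<forall>k\<ge>M. \<forall>n\<ge>M. dist (X k) (X n) < e" by blast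
  qed
  then obtain z where z: "X \<longlonglongrightarrow> z" using Cauchy_convergent convergentD by blast
  have "(\<lambda>n. J (X n)) \<longlonglongrightarrow> J z"
    unfolding J_def by (intro tendsto_intros z f.tendsto)
  moreover have "(\<lambda>n. m + inverse (real (Suc n))) \<longlonglongrightarrow> m + 0"
    by (intro tendsto_intros LIMSEQ_inverse_real_of_nat)
  ultimately have Jz: "J z \<le> m"
    using LIMSEQ_le[of "\<lambda>n. J (X n)" "J z" "\<lambda>n. m + inverse (real (Suc n))" m] X less_imp_le by auto
  have "f h = Re (cinner h z)" for h
  proof -
    define d where "d = Re (cinner z h) - f h"
    have *: "0 \<le> 2 * t * d + t\<^sup>2 * (norm h)\<^sup>2" for t
      using m_le[of "z + t *\<^sub>R h"] Jz
      by (simp add: J_def power2_norm_add f.add f.scaleR cinner_scaleR_right d_def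
          power_mult_distrib algebra_simps)
    define N where "N = (norm h)\<^sup>2 + 1"
    have N: "N > 0" unfolding N_def by (simp add: add_nonneg_pos)
    have "0 \<le> 2 * (- d / N) * d + (- d / N)\<^sup>2 * (N - 1)"
      using *[of "- d / N"] by (simp add: N_def)
    also have "\<dots> = - (d\<^sup>2 * (N + 1) / N\<^sup>2)"
      using N by (simp add: field_simps power2_eq_square)
    finally have "d\<^sup>2 * (N + 1) / N\<^sup>2 \<le> 0" by simp
    then have "d = 0" using N by (simp add: divide_le_0_iff mult_le_0_iff)
    then show ?thesis unfolding d_def by (subst cinner_commute) simp
  qed
  then show ?thesis by blast
qed

lemma ex_adj:
  fixes A :: "'a::chilbert_space bop"
  shows "\<exists>B. \<forall>x y. cinner (bop_apply A x) y = cinner x (bop_apply B y)"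
proof -
  interpret A: bounded_linear "bop_apply A" by (rule bounded_linear_bop_apply)
  have "\<exists>z. \<forall>x. cinner (bop_apply A x) y = cinner x z" for y
  proof -
    have "bounded_linear (\<lambda>x. Re (cinner (A x) y))"
    proof (rule bounded_linear_intro[where K = "norm A * norm y"])
      fix x
      have "\<bar>Re (cinner (A x) y)\<bar> \<le> norm (A x) * norm y"
        using Re_cinner_le[of "A x" y] Re_cinner_le[of "- A x" y] by (simp add: cinner_minus_left)
      also have "\<dots> \<le> norm A * norm x * norm y"
        by (intro mult_right_mono norm_bop_le) simp
      finally show "norm (Re (cinner (A x) y)) \<le> norm x * (norm A * norm y)"
        by (simp add: mult_ac)
    qed (simp_all add: A.add A.scaleR cinner_add_left scaleR_scaleC bop_apply_scaleC
        cinner_scaleC_left)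
    then obtain z where z: "\<And>x. Re (cinner (A x) y) = Re (cinner x z)"
      using riesz_real[of "\<lambda>x. Re (cinner (A x) y)"] by auto
    have "cinner (A x) y = cinner x z" for x
      using z[of x] z[of "\<i> *\<^sub>C x"]
      by (simp add: bop_apply_scaleC cinner_scaleC_left complex_eq_iff)
    then show ?thesis by blast
  qed
  then obtain g where g: "\<And>x y. cinner (A x) y = cinner x (g y)" by metis
  have add: "g (x + y) = g x + g y" for x y
    by (rule cinner_left_ext) (simp add: g[symmetric] cinner_add_right)
  have scaleC: "g (c *\<^sub>C x) = c *\<^sub>C g x" for c x
    by (rule cinner_left_ext) (simp add: g[symmetric] cinner_scaleC_right)
  have "norm (g y) \<le> norm y * norm A" for y
  proof -
    have "(norm (g y))\<^sup>2 = Re (cinner (A (g y)) y)" by (simp add: power2_norm_eq_cinner g)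
    also have "\<dots> \<le> norm (A (g y)) * norm y" by (rule Re_cinner_le)
    also have "\<dots> \<le> norm A * norm (g y) * norm y" by (intro mult_right_mono norm_bop_le) simp
    finally have "norm (g y) * norm (g y) \<le> norm (g y) * (norm y * norm A)"
      by (simp add: power2_eq_square mult_ac)
    then show ?thesis by (cases "norm (g y) = 0") (auto simp: mult_le_cancel_left_pos)
  qed
  then have g_blf: "bounded_linear g"
    by (intro bounded_linear_intro[where K = "norm A"]) (simp_all add: add scaleC scaleR_scaleC)
  then have "bop_apply (Bop (Blinfun g)) = g"
    by (simp add: bop_apply.rep_eq Bop_inverse bounded_linear_Blinfun_apply scaleC)
  then show ?thesis using g by metis
qed

lemma cinner_adj: "cinner (bop_apply A x) y = cinner x (bop_apply (A\<^sup>\<star>) y)"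
proof -
  obtain B where B: "\<forall>x y. cinner (bop_apply A x) y = cinner x (bop_apply B y)"
    using ex_adj[of A] ..
  have "\<exists>!B. \<forall>x y. cinner (bop_apply A x) y = cinner x (bop_apply B y)"
  proof (rule ex1I)
    show "\<forall>x y. cinner (bop_apply A x) y = cinner x (bop_apply B y)" by (rule B)
  next
    fix C assume C: "\<forall>x y. cinner (bop_apply A x) y = cinner x (bop_apply C y)"
    have "cinner x (bop_apply C y) = cinner x (bop_apply B y)" for x y
      using B[rule_format, of x y] C[rule_format, of x y] by simp
    then show "C = B" by (rule bop_eqI[OF cinner_left_ext])
  qed
  from theI'[OF this, folded adj_def] show ?thesis by simp
qed

end

theory Submission
  imports Defs
begin

text \<open>
  All the conditions say that some \<open>\<mu>\<close> with \<open>\<bar>\<mu>\<bar> = \<parallel>T\<parallel>\<close> is an approximate eigenvalue of \<open>T\<close>, that is,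
  that \<open>T - \<mu>\<close> is not bounded below. Condition (iii) is this statement written with a sequence.

  The link with parallelism is the numerical range. If \<open>\<parallel>S\<parallel> \<le> s\<close>, \<open>\<bar>\<alpha>\<bar> = 1\<close> and \<open>\<xi>\<close> is a unit vector, then
  expanding the square gives \<open>\<parallel>S \<xi> - \<alpha> s \<xi>\<parallel>\<^sup>2 \<le> 2 s (s - Re \<langle>S \<xi>, \<alpha> \<xi>\<rangle>)\<close>, so \<open>\<alpha> s\<close> is an approximate
  eigenvalue as soon as \<open>Re \<langle>S \<xi>, \<alpha> \<xi>\<rangle>\<close> comes arbitrarily close to \<open>s\<close>
  (\<open>approx_eigenvalue_if_numerical\<close>).

  If \<open>\<parallel>T + \<alpha> I\<parallel> = \<parallel>T\<parallel> + 1\<close>, choose \<open>\<xi>\<close> almost attaining the norm of \<open>T + \<alpha> I\<close>: the cross term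
  \<open>Re \<langle>T \<xi>, \<alpha> \<xi>\<rangle>\<close> must be almost \<open>\<parallel>T\<parallel>\<close>. Conversely an approximate eigenvector for \<open>\<alpha> \<parallel>T\<parallel>\<close> almost attains
  \<open>\<parallel>T\<parallel> + 1\<close> under \<open>T + \<alpha> I\<close> and, since \<open>\<langle>T\<^sup>\<star> \<xi>, \<xi>\<rangle>\<close> is conjugate to \<open>\<langle>T \<xi>, \<xi>\<rangle>\<close>, almost
  attains \<open>2 \<parallel>T\<parallel>\<close> under \<open>T + \<alpha>\<^sup>2 T\<^sup>\<star>\<close>.

  If \<open>\<parallel>T + \<alpha> T\<^sup>\<star>\<parallel> = 2 \<parallel>T\<parallel>\<close>, the cross term is \<open>Re \<langle>T \<xi>, \<alpha> T\<^sup>\<star> \<xi>\<rangle> = Re \<langle>T\<^sup>2 \<xi>, \<alpha> \<xi>\<rangle>\<close>, so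
  \<open>\<alpha> \<parallel>T\<parallel>\<^sup>2\<close> is an approximate eigenvalue of \<open>T\<^sup>2\<close>. With \<open>\<mu>\<^sup>2 = \<alpha> \<parallel>T\<parallel>\<^sup>2\<close>, the factorisation
  \<open>T\<^sup>2 - \<mu>\<^sup>2 = (T - \<mu>) (T + \<mu>)\<close> shows that \<open>\<mu>\<close> or \<open>- \<mu>\<close> is an approximate
  eigenvalue of \<open>T\<close>
  (\<open>approx_eigenvalue_square_root\<close>).

  Finally, if \<open>\<mu>\<close> is an approximate eigenvalue of \<open>T\<close> with \<open>\<bar>\<mu>\<bar> = \<parallel>T\<parallel>\<close>, then \<open>\<mu>\<^sup>m\<close> is one of \<open>T\<^sup>m\<close>, and
  \<open>\<bar>\<mu>\<^sup>m\<bar> = \<parallel>T\<parallel>\<^sup>m \<ge> \<parallel>T\<^sup>m\<parallel>\<close>. This gives (iv), and (v) is the equivalence of (i) and (ii) for \<open>T\<^sup>m\<close>,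
  whose adjoint is \<open>(T\<^sup>\<star>)\<^sup>m\<close>.
\<close>

section \<open>Inner products and adjoints\<close>

lemma norm_diff_power2:
  fixes x y :: "'a::complex_inner"
  shows "(norm (x - y))\<^sup>2 = (norm x)\<^sup>2 - 2 * Re (cinner x y) + (norm y)\<^sup>2"
  using power2_norm_add[of x "- y"] by (simp add: cinner_minus_right)

lemma adj_eqI:
  assumes "\<And>x y. cinner (bop_apply A x) y = cinner x (bop_apply B y)"
  shows "A\<^sup>\<star> = B"
  by (rule bop_eqI, rule cinner_left_ext) (simp add: assms flip: cinner_adj)

lemma adj_adj: "(A\<^sup>\<star>)\<^sup>\<star> = A"
proof (rule adj_eqI)
  fix x y
  show "cinner (bop_apply (A\<^sup>\<star>) x) y = cinner x (bop_apply A y)"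
    using cinner_adj[of A y x] by (metis cinner_commute)
qed

lemma adj_power: "(A ^ m)\<^sup>\<star> = (A\<^sup>\<star>) ^ m"
proof (rule adj_eqI)
  show "cinner (bop_apply (A ^ m) x) y = cinner x (bop_apply ((A\<^sup>\<star>) ^ m) y)" for x y
  proof (induction m arbitrary: y)
    case (Suc m)
    have "cinner ((A ^ Suc m) x) y = cinner ((A ^ m) x) ((A\<^sup>\<star>) y)" by (simp add: cinner_adj)
    also have "\<dots> = cinner x (((A\<^sup>\<star>) ^ m) ((A\<^sup>\<star>) y))" by (rule Suc)
    also have "((A\<^sup>\<star>) ^ m) ((A\<^sup>\<star>) y) = ((A\<^sup>\<star>) ^ Suc m) y" by (simp add: power_Suc2 del: power_Suc)
    finally show ?case .
  qed simp
qed

lemma norm_adj_le: "norm (A\<^sup>\<star>) \<le> norm A"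
proof (rule norm_bop_bound)
  fix y
  have "(norm ((A\<^sup>\<star>) y))\<^sup>2 = Re (cinner (A ((A\<^sup>\<star>) y)) y)"
    by (simp add: power2_norm_eq_cinner cinner_adj)
  also have "\<dots> \<le> norm (A ((A\<^sup>\<star>) y)) * norm y" by (rule Re_cinner_le)
  also have "\<dots> \<le> norm A * norm ((A\<^sup>\<star>) y) * norm y" by (intro mult_right_mono norm_bop_le) simp
  finally have "norm ((A\<^sup>\<star>) y) * norm ((A\<^sup>\<star>) y) \<le> norm ((A\<^sup>\<star>) y) * (norm A * norm y)"
    by (simp add: power2_eq_square mult_ac)
  then show "norm ((A\<^sup>\<star>) y) \<le> norm A * norm y"
    by (cases "norm ((A\<^sup>\<star>) y) = 0") (auto simp: mult_le_cancel_left_pos)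
qed simp

lemma norm_adj: "norm (A\<^sup>\<star>) = norm A"
  using norm_adj_le[of A] norm_adj_le[of "A\<^sup>\<star>"] by (simp add: adj_adj)

section \<open>Norms of operators\<close>

lemma norm_bop_unit_le: "norm \<xi> = 1 \<Longrightarrow> norm (bop_apply A \<xi>) \<le> norm A"
  using norm_bop_le[of A \<xi>] by simp

lemma norm_bop_times_le: "norm (A * B :: 'a::complex_normed_vector bop) \<le> norm A * norm B"
proof (rule norm_bop_bound)
  fix x
  have "norm (A (B x)) \<le> norm A * norm (B x)" by (rule norm_bop_le)
  also have "\<dots> \<le> norm A * (norm B * norm x)" by (intro mult_left_mono norm_bop_le) simp
  finally show "norm ((A * B) x) \<le> norm A * norm B * norm x" by (simp add: mult.assoc)
qed simp

lemma norm_bop_one_le: "norm (1 :: 'a::complex_normed_vector bop) \<le> 1"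
  by (rule norm_bop_bound) simp_all

lemma norm_bop_power_le: "norm (A ^ m :: 'a::complex_normed_vector bop) \<le> norm A ^ m"
proof (induction m)
  case (Suc m)
  have "norm (A ^ Suc m) \<le> norm A * norm (A ^ m)" by (simp add: norm_bop_times_le)
  also have "\<dots> \<le> norm A * norm A ^ m" by (intro mult_left_mono Suc) simp
  finally show ?case by simp
qed (simp add: norm_bop_one_le)

lemma norm_bop_one:
  assumes "\<exists>x::'a::complex_normed_vector. x \<noteq> 0"
  shows "norm (1 :: 'a bop) = 1"
proof -
  obtain x :: 'a where "x \<noteq> 0" using assms by blast
  then have "1 \<le> norm (1 :: 'a bop)" using norm_bop_le[of 1 x] by simp
  then show ?thesis using norm_bop_one_le by (rule antisym[rotated])
qed

lemma unit_vector_norm_gt: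
  fixes A :: "'a::complex_normed_vector bop"
  assumes nonzero: "\<exists>x::'a. x \<noteq> 0" and b: "b < norm A"
  shows "\<exists>\<xi>. norm \<xi> = 1 \<and> b < norm (A \<xi>)"
proof (rule ccontr)
  assume "\<not> ?thesis"
  then have le: "norm (A \<xi>) \<le> b" if "norm \<xi> = 1" for \<xi>
    using that by (meson not_le)
  obtain x :: 'a where "x \<noteq> 0" using nonzero by blast
  then have "0 \<le> b" using order_trans[OF norm_ge_zero le[of "sgn x"]] by (simp add: norm_sgn)
  moreover have "norm (A x) \<le> b * norm x" for x
  proof (cases "x = 0")
    case True
    then show ?thesis using norm_bop_le[of A x] by simp
  next
    case False
    interpret A: bounded_linear "bop_apply A" by (rule bounded_linear_bop_apply)
    have "norm (A (sgn x)) \<le> b" using False by (intro le) (simp add: norm_sgn)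
    then show ?thesis using False by (simp add: sgn_div_norm A.scaleR field_simps)
  qed
  ultimately have "norm A \<le> b" by (rule norm_bop_bound)
  with b show False by simp
qed

section \<open>Approximate eigenvalues\<close>

definition approx_eigenvalue :: "'a::complex_normed_vector bop \<Rightarrow> complex \<Rightarrow> bool" where
  "approx_eigenvalue A \<mu> \<longleftrightarrow> (\<forall>e>0. \<exists>\<xi>. norm \<xi> = 1 \<and> norm (A \<xi> - \<mu> *\<^sub>C \<xi>) < e)"

lemma approx_eigenvalue_iff_sequence:
  "approx_eigenvalue A \<mu> \<longleftrightarrow>
    (\<exists>\<xi>. (\<forall>n::nat. norm (\<xi> n) = 1) \<and> (\<lambda>n. norm (A (\<xi> n) - \<mu> *\<^sub>C \<xi> n)) \<longlonglongrightarrow> 0)"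
proof
  assume "approx_eigenvalue A \<mu>"
  then have "\<exists>\<xi>. norm \<xi> = 1 \<and> norm (A \<xi> - \<mu> *\<^sub>C \<xi>) < inverse (real (Suc n))" for n
    by (simp add: approx_eigenvalue_def)
  then obtain \<xi> where \<xi>: "\<And>n. norm (\<xi> n) = 1"
    "\<And>n. norm (A (\<xi> n) - \<mu> *\<^sub>C \<xi> n) < inverse (real (Suc n))" by metis
  have "(\<lambda>n. norm (A (\<xi> n) - \<mu> *\<^sub>C \<xi> n)) \<longlonglongrightarrow> 0"
    by (rule tendsto_sandwich[OF _ _ tendsto_const LIMSEQ_inverse_real_of_nat])
      (use less_imp_le[OF \<xi>(2)] in simp_all)
  with \<xi>(1) show "\<exists>\<xi>. (\<forall>n::nat. norm (\<xi> n) = 1) \<and> (\<lambda>n. norm (A (\<xi> n) - \<mu> *\<^sub>C \<xi> n)) \<longlonglongrightarrow> 0"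
    by blast
next
  assume "\<exists>\<xi>. (\<forall>n::nat. norm (\<xi> n) = 1) \<and> (\<lambda>n. norm (A (\<xi> n) - \<mu> *\<^sub>C \<xi> n)) \<longlonglongrightarrow> 0"
  then obtain \<xi> where \<xi>: "\<And>n::nat. norm (\<xi> n) = 1"
    and lim: "(\<lambda>n. norm (A (\<xi> n) - \<mu> *\<^sub>C \<xi> n)) \<longlonglongrightarrow> 0" by blast
  show "approx_eigenvalue A \<mu>"
    unfolding approx_eigenvalue_def
  proof (intro allI impI)
    fix e :: real assume "e > 0"
    then obtain n where "norm (A (\<xi> n) - \<mu> *\<^sub>C \<xi> n) < e"
      using eventually_happens'[OF sequentially_bot order_tendstoD(2)[OF lim]] by blast
    with \<xi> show "\<exists>\<xi>. norm \<xi> = 1 \<and> norm (A \<xi> - \<mu> *\<^sub>C \<xi>) < e" by blast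
  qed
qed

lemma not_approx_eigenvalue_bounded_below:
  assumes "\<not> approx_eigenvalue A \<mu>"
  shows "\<exists>e>0. \<forall>x. e * norm x \<le> norm (A x - \<mu> *\<^sub>C x)"
proof -
  interpret A: bounded_linear "bop_apply A" by (rule bounded_linear_bop_apply)
  obtain e where e: "e > 0" "\<And>\<xi>. norm \<xi> = 1 \<Longrightarrow> e \<le> norm (A \<xi> - \<mu> *\<^sub>C \<xi>)"
    using assms unfolding approx_eigenvalue_def by (meson not_le)
  have "e * norm x \<le> norm (A x - \<mu> *\<^sub>C x)" for x
  proof (cases "x = 0")
    case False
    have "A (sgn x) - \<mu> *\<^sub>C sgn x = (1 / norm x) *\<^sub>R (A x - \<mu> *\<^sub>C x)"
      by (simp add: sgn_div_norm A.scaleR scaleC_scaleR scaleR_diff_right divide_inverse)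
    then have "norm (A (sgn x) - \<mu> *\<^sub>C sgn x) = norm (A x - \<mu> *\<^sub>C x) / norm x" by simp
    moreover have "e \<le> norm (A (sgn x) - \<mu> *\<^sub>C sgn x)"
      using False by (intro e(2)) (simp add: norm_sgn)
    ultimately show ?thesis using False by (simp add: pos_le_divide_eq)
  qed simp
  with e(1) show ?thesis by blast
qed

lemma approx_eigenvalue_norm_le:
  assumes "approx_eigenvalue A \<mu>"
  shows "cmod \<mu> \<le> norm A"
proof (rule field_le_epsilon)
  fix e :: real assume "e > 0"
  then obtain \<xi> where \<xi>: "norm \<xi> = 1" "norm (A \<xi> - \<mu> *\<^sub>C \<xi>) < e"
    using assms unfolding approx_eigenvalue_def by blast
  have "cmod \<mu> = norm (\<mu> *\<^sub>C \<xi>)" by (simp add: norm_scaleC \<xi>)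
  also have "\<dots> \<le> norm (A \<xi>) + norm (A \<xi> - \<mu> *\<^sub>C \<xi>)" by norm
  finally show "cmod \<mu> \<le> norm A + e" using \<xi> norm_bop_unit_le[of \<xi> A] by linarith
qed

text \<open>
  The operator \<open>A - \<mu>\<close> is a right factor of \<open>A\<^sup>m - \<mu>\<^sup>m\<close>, so vectors that are almost annihilated by the
  former are almost annihilated by the latter.
\<close>
lemma approx_eigenvalue_power:
  assumes "approx_eigenvalue A \<mu>"
  shows "approx_eigenvalue (A ^ m) (\<mu> ^ m)"
proof -
  interpret A: bounded_linear "bop_apply A" by (rule bounded_linear_bop_apply)
  have "\<exists>C\<ge>0. \<forall>x. norm ((A ^ m) x - \<mu> ^ m *\<^sub>C x) \<le> C * norm (A x - \<mu> *\<^sub>C x)"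
  proof (induction m)
    case 0
    show ?case by (rule exI[of _ 0]) (simp add: scaleC_one)
  next
    case (Suc m)
    then obtain C where C: "0 \<le> C"
      "\<And>x. norm ((A ^ m) x - \<mu> ^ m *\<^sub>C x) \<le> C * norm (A x - \<mu> *\<^sub>C x)" by blast
    have "norm ((A ^ Suc m) x - \<mu> ^ Suc m *\<^sub>C x)
        \<le> (norm A * C + cmod \<mu> ^ m) * norm (A x - \<mu> *\<^sub>C x)" for x
    proof -
      have "(A ^ Suc m) x - \<mu> ^ Suc m *\<^sub>C x
          = A ((A ^ m) x - \<mu> ^ m *\<^sub>C x) + \<mu> ^ m *\<^sub>C (A x - \<mu> *\<^sub>C x)"
        by (simp add: A.diff bop_apply_scaleC scaleC_diff_right scaleC_scaleC mult.commute)
      then have "norm ((A ^ Suc m) x - \<mu> ^ Suc m *\<^sub>C x)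
          \<le> norm (A ((A ^ m) x - \<mu> ^ m *\<^sub>C x)) + norm (\<mu> ^ m *\<^sub>C (A x - \<mu> *\<^sub>C x))"
        by (simp only: norm_triangle_ineq)
      also have "\<dots> \<le> norm A * (C * norm (A x - \<mu> *\<^sub>C x)) + cmod \<mu> ^ m * norm (A x - \<mu> *\<^sub>C x)"
        by (intro add_mono order_trans[OF norm_bop_le] mult_left_mono C(2))
          (simp_all add: norm_scaleC norm_power)
      finally show ?thesis by (simp add: algebra_simps)
    qed
    moreover have "0 \<le> norm A * C + cmod \<mu> ^ m" using C(1) by simp
    ultimately show ?case by blast
  qed
  then obtain C where C: "0 \<le> C"
    "\<And>x. norm ((A ^ m) x - \<mu> ^ m *\<^sub>C x) \<le> C * norm (A x - \<mu> *\<^sub>C x)" by blast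
  show ?thesis
    unfolding approx_eigenvalue_def
  proof (intro allI impI)
    fix e :: real assume e: "e > 0"
    have "e / (C + 1) > 0" using e C(1) by simp
    then obtain \<xi> where \<xi>: "norm \<xi> = 1" "norm (A \<xi> - \<mu> *\<^sub>C \<xi>) < e / (C + 1)"
      using assms unfolding approx_eigenvalue_def by blast
    have "norm ((A ^ m) \<xi> - \<mu> ^ m *\<^sub>C \<xi>) \<le> C * norm (A \<xi> - \<mu> *\<^sub>C \<xi>)" by (rule C(2))
    also have "\<dots> \<le> C * (e / (C + 1))" using \<xi>(2) C(1) by (intro mult_left_mono) simp_all
    also have "\<dots> < e" using e C(1) by (simp add: field_simps)
    finally show "\<exists>\<xi>. norm \<xi> = 1 \<and> norm ((A ^ m) \<xi> - \<mu> ^ m *\<^sub>C \<xi>) < e" using \<xi>(1) by blast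
  qed
qed

text \<open>
  Since \<open>A\<^sup>2 - \<mu>\<^sup>2 = (A - \<mu>) (A + \<mu>)\<close>, it would be bounded below if both factors were.
\<close>
lemma approx_eigenvalue_square_root:
  assumes sq: "approx_eigenvalue (A ^ 2) (\<mu> ^ 2)"
  shows "approx_eigenvalue A \<mu> \<or> approx_eigenvalue A (- \<mu>)"
proof (rule ccontr)
  interpret A: bounded_linear "bop_apply A" by (rule bounded_linear_bop_apply)
  assume "\<not> ?thesis"
  then obtain c d where c: "c > 0" "\<And>x. c * norm x \<le> norm (A x - \<mu> *\<^sub>C x)"
    and d: "d > 0" "\<And>x. d * norm x \<le> norm (A x - (- \<mu>) *\<^sub>C x)"
    using not_approx_eigenvalue_bounded_below[of A] by (metis (no_types))
  have "c * d > 0" using c(1) d(1) by simp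
  then obtain \<xi> where \<xi>: "norm \<xi> = 1" "norm ((A ^ 2) \<xi> - \<mu> ^ 2 *\<^sub>C \<xi>) < c * d"
    using sq unfolding approx_eigenvalue_def by blast
  define y where "y = A \<xi> - (- \<mu>) *\<^sub>C \<xi>"
  have y_eq: "y = A \<xi> + \<mu> *\<^sub>C \<xi>"
    using scaleC_add_left[of "- \<mu>" \<mu> \<xi>] by (simp add: y_def eq_neg_iff_add_eq_0 algebra_simps)
  have "A y - \<mu> *\<^sub>C y = (A ^ 2) \<xi> - \<mu> ^ 2 *\<^sub>C \<xi>"
    by (simp add: y_eq A.add bop_apply_scaleC scaleC_add_right scaleC_scaleC power2_eq_square)
  then have "c * norm y < c * d" using c(2)[of y] \<xi>(2) by simp
  moreover have "d \<le> norm y" using d(2)[of \<xi>] \<xi>(1) by (simp add: y_def)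
  ultimately show False using c(1) by simp
qed

text \<open>
  For a unit vector, \<open>\<parallel>S \<xi> - \<alpha> s \<xi>\<parallel>\<^sup>2 = \<parallel>S \<xi>\<parallel>\<^sup>2 - 2 s Re \<langle>S \<xi>, \<alpha> \<xi>\<rangle> + s\<^sup>2\<close>, and \<open>\<parallel>S \<xi>\<parallel> \<le> s\<close>.
\<close>
lemma approx_eigenvalue_if_numerical:
  fixes S :: "'a::complex_inner bop"
  assumes S: "norm S \<le> s" and \<alpha>: "cmod \<alpha> = 1"
    and num: "\<And>e. e > 0 \<Longrightarrow> \<exists>\<xi>. norm \<xi> = 1 \<and> s - e < Re (cinner (S \<xi>) (\<alpha> *\<^sub>C \<xi>))"
  shows "approx_eigenvalue S (\<alpha> * complex_of_real s)"
  unfolding approx_eigenvalue_def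
proof (intro allI impI)
  fix e :: real assume e: "e > 0"
  have s: "0 \<le> s" using S norm_ge_zero order_trans by blast
  define \<delta> where "\<delta> = e\<^sup>2 / (2 * s + 1)"
  have \<delta>: "\<delta> > 0" using e s by (simp add: \<delta>_def)
  obtain \<xi> where \<xi>: "norm \<xi> = 1" "s - \<delta> < Re (cinner (S \<xi>) (\<alpha> *\<^sub>C \<xi>))"
    using num[OF \<delta>] by blast
  have "(norm (S \<xi>))\<^sup>2 \<le> s\<^sup>2" using norm_bop_unit_le[OF \<xi>(1), of S] S by (intro power_mono) simp_all
  moreover have "(\<alpha> * complex_of_real s) *\<^sub>C \<xi> = s *\<^sub>R \<alpha> *\<^sub>C \<xi>"
    by (simp add: scaleR_scaleC scaleC_scaleC mult.commute)
  moreover have "s * (s - \<delta>) \<le> s * Re (cinner (S \<xi>) (\<alpha> *\<^sub>C \<xi>))"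
    using \<xi>(2) s by (intro mult_left_mono) simp_all
  ultimately have "(norm (S \<xi> - (\<alpha> * complex_of_real s) *\<^sub>C \<xi>))\<^sup>2 \<le> 2 * s * \<delta>"
    using \<xi>(1) \<alpha> norm_diff_power2[of "S \<xi>" "s *\<^sub>R \<alpha> *\<^sub>C \<xi>"]
    by (simp add: cinner_scaleR_right norm_scaleC power2_eq_square algebra_simps)
  also have "\<dots> < e\<^sup>2" using e s by (simp add: \<delta>_def field_simps)
  finally have "norm (S \<xi> - (\<alpha> * complex_of_real s) *\<^sub>C \<xi>) < e" using e by (simp add: power2_less_imp_less)
  with \<xi>(1) show "\<exists>\<xi>. norm \<xi> = 1 \<and> norm (S \<xi> - (\<alpha> * complex_of_real s) *\<^sub>C \<xi>) < e" by blast
qed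

section \<open>Parallelism and approximate eigenvalues\<close>

text \<open>
  A unit vector almost attaining the norm of \<open>A + \<alpha> B\<close> makes the cross term in \<open>\<parallel>A \<xi> + \<alpha> B \<xi>\<parallel>\<^sup>2\<close> almost
  as large as the Cauchy-Schwarz inequality allows, because the other two terms are at most \<open>\<parallel>A\<parallel>\<^sup>2\<close>
  and \<open>\<parallel>B\<parallel>\<^sup>2\<close>.
\<close>
lemma parallel_cross_term:
  fixes A B :: "'a::complex_inner bop"
  assumes nonzero: "\<exists>x::'a. x \<noteq> 0" and \<alpha>: "cmod \<alpha> = 1"
    and par: "norm (A + \<alpha> *\<^sub>C B) = norm A + norm B" and e: "e > 0"
  shows "\<exists>\<xi>. norm \<xi> = 1 \<and> norm A * norm B - e < Re (cinner (A \<xi>) (\<alpha> *\<^sub>C B \<xi>))"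
proof -
  define k where "k = norm A + norm B"
  have k: "0 \<le> k" by (simp add: k_def)
  define \<delta> where "\<delta> = e / (k + 1)"
  have \<delta>: "\<delta> > 0" using e k by (simp add: \<delta>_def)
  obtain \<xi> where \<xi>: "norm \<xi> = 1" "k - \<delta> < norm ((A + \<alpha> *\<^sub>C B) \<xi>)"
    using unit_vector_norm_gt[OF nonzero, of "k - \<delta>" "A + \<alpha> *\<^sub>C B"] \<delta> par by (auto simp: k_def)
  define n where "n = norm ((A + \<alpha> *\<^sub>C B) \<xi>)"
  have n: "0 \<le> n" "n \<le> k" "k - \<delta> < n"
    using \<xi> norm_bop_unit_le[OF \<xi>(1), of "A + \<alpha> *\<^sub>C B"] par by (simp_all add: n_def k_def)
  have "k\<^sup>2 - n\<^sup>2 = (k - n) * (k + n)" by (simp add: power2_eq_square algebra_simps)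
  also have "\<dots> \<le> \<delta> * (2 * k)" using n k \<delta> by (intro mult_mono) simp_all
  also have "\<dots> < 2 * e" using e k by (simp add: \<delta>_def field_simps)
  finally have 1: "k\<^sup>2 - 2 * e < n\<^sup>2" by simp
  have 2: "n\<^sup>2 = (norm (A \<xi>))\<^sup>2 + 2 * Re (cinner (A \<xi>) (\<alpha> *\<^sub>C B \<xi>)) + (norm (B \<xi>))\<^sup>2"
    using \<alpha> by (simp add: n_def bop_apply_add_left bop_apply_scaleC_left power2_norm_add norm_scaleC)
  have 3: "(norm (A \<xi>))\<^sup>2 \<le> (norm A)\<^sup>2" "(norm (B \<xi>))\<^sup>2 \<le> (norm B)\<^sup>2"
    using norm_bop_unit_le[OF \<xi>(1)] by (simp_all add: power_mono)
  have "k\<^sup>2 = (norm A)\<^sup>2 + (norm B)\<^sup>2 + 2 * (norm A * norm B)" by (simp add: k_def power2_sum)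
  with 1 2 3 have "norm A * norm B - e < Re (cinner (A \<xi>) (\<alpha> *\<^sub>C B \<xi>))" by linarith
  with \<xi>(1) show ?thesis by blast
qed

lemma parallel_one_iff_approx_eigenvalue:
  fixes T :: "'a::complex_inner bop"
  assumes nonzero: "\<exists>x::'a. x \<noteq> 0"
  shows "T \<parallel> 1 \<longleftrightarrow> (\<exists>\<alpha>. cmod \<alpha> = 1 \<and> approx_eigenvalue T (\<alpha> * complex_of_real (norm T)))"
proof
  assume "T \<parallel> 1"
  then obtain \<alpha> where \<alpha>: "cmod \<alpha> = 1" "norm (T + \<alpha> *\<^sub>C 1) = norm T + norm (1 :: 'a bop)"
    unfolding parallel_def by blast
  have "approx_eigenvalue T (\<alpha> * complex_of_real (norm T))"
    using parallel_cross_term[OF nonzero \<alpha>]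
    by (intro approx_eigenvalue_if_numerical \<alpha>) (simp_all add: norm_bop_one[OF nonzero])
  with \<alpha>(1) show "\<exists>\<alpha>. cmod \<alpha> = 1 \<and> approx_eigenvalue T (\<alpha> * complex_of_real (norm T))" by blast
next
  assume "\<exists>\<alpha>. cmod \<alpha> = 1 \<and> approx_eigenvalue T (\<alpha> * complex_of_real (norm T))"
  then obtain \<alpha> where \<alpha>: "cmod \<alpha> = 1" "approx_eigenvalue T (\<alpha> * complex_of_real (norm T))" by blast
  let ?\<mu> = "\<alpha> * complex_of_real (norm T)"
  have "norm T + 1 \<le> norm (T + \<alpha> *\<^sub>C 1)"
  proof (rule field_le_epsilon)
    fix e :: real assume "e > 0"
    then obtain \<xi> where \<xi>: "norm \<xi> = 1" "norm (T \<xi> - ?\<mu> *\<^sub>C \<xi>) < e"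
      using \<alpha>(2) unfolding approx_eigenvalue_def by blast
    have "?\<mu> + \<alpha> = \<alpha> * complex_of_real (norm T + 1)" by (simp add: algebra_simps)
    then have "norm T + 1 = norm ((?\<mu> + \<alpha>) *\<^sub>C \<xi>)"
      using \<alpha>(1) \<xi>(1) by (simp add: norm_scaleC norm_mult del: of_real_add)
    also have "\<dots> = norm (?\<mu> *\<^sub>C \<xi> + \<alpha> *\<^sub>C \<xi>)" by (simp add: scaleC_add_left)
    also have "\<dots> \<le> norm (T \<xi> + \<alpha> *\<^sub>C \<xi>) + norm (T \<xi> - ?\<mu> *\<^sub>C \<xi>)" by norm
    also have "T \<xi> + \<alpha> *\<^sub>C \<xi> = (T + \<alpha> *\<^sub>C 1) \<xi>"
      by (simp add: bop_apply_add_left bop_apply_scaleC_left)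
    finally show "norm T + 1 \<le> norm (T + \<alpha> *\<^sub>C 1) + e"
      using \<xi> norm_bop_unit_le[OF \<xi>(1), of "T + \<alpha> *\<^sub>C 1"] by linarith
  qed
  moreover have "norm (T + \<alpha> *\<^sub>C 1) \<le> norm T + norm (\<alpha> *\<^sub>C (1 :: 'a bop))"
    by (rule norm_triangle_ineq)
  ultimately show "T \<parallel> 1"
    using \<alpha>(1) unfolding parallel_def
    by (intro exI[of _ \<alpha>]) (simp add: norm_scaleC norm_bop_one[OF nonzero])
qed

lemma parallel_adj_if_approx_eigenvalue:
  fixes T :: "'a::chilbert_space bop"
  assumes \<alpha>: "cmod \<alpha> = 1" and ev: "approx_eigenvalue T (\<alpha> * complex_of_real (norm T))"
  shows "T \<parallel> T\<^sup>\<star>"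
proof -
  let ?\<mu> = "\<alpha> * complex_of_real (norm T)"
  have \<alpha>\<alpha>: "\<alpha> * cnj \<alpha> = 1" using \<alpha> complex_norm_square[of \<alpha>] by simp
  have "2 * norm T \<le> norm (T + \<alpha>\<^sup>2 *\<^sub>C T\<^sup>\<star>)"
  proof (rule field_le_epsilon)
    fix e :: real assume "e > 0"
    then have "e / 2 > 0" by simp
    then obtain \<xi> where \<xi>: "norm \<xi> = 1" "norm (T \<xi> - ?\<mu> *\<^sub>C \<xi>) < e / 2"
      using ev unfolding approx_eigenvalue_def by blast
    have \<xi>\<xi>: "cinner \<xi> \<xi> = 1"
      using power2_norm_eq_cinner[of \<xi>] cinner_commute[of \<xi> \<xi>] \<xi>(1) by (simp add: complex_eq_iff)
    define q where "q = Re (cinner (T \<xi>) (\<alpha> *\<^sub>C \<xi>))"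
    have "Re (cinner (?\<mu> *\<^sub>C \<xi> - T \<xi>) (\<alpha> *\<^sub>C \<xi>)) \<le> norm (?\<mu> *\<^sub>C \<xi> - T \<xi>) * norm (\<alpha> *\<^sub>C \<xi>)"
      by (rule Re_cinner_le)
    also have "cinner (?\<mu> *\<^sub>C \<xi>) (\<alpha> *\<^sub>C \<xi>) = \<alpha> * cnj \<alpha> * norm T"
      by (simp add: cinner_scaleC_left cinner_scaleC_right \<xi>\<xi>)
    then have "Re (cinner (?\<mu> *\<^sub>C \<xi> - T \<xi>) (\<alpha> *\<^sub>C \<xi>)) = norm T - q"
      by (simp add: cinner_diff_left \<alpha>\<alpha> q_def)
    finally have q: "norm T - e / 2 \<le> q"
      using \<xi> \<alpha> by (simp add: norm_scaleC norm_minus_commute)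
    \<comment> \<open>The two terms of \<open>T + \<alpha>\<^sup>2 T\<^sup>\<star>\<close> contribute complex conjugate numbers.\<close>
    have "cinner ((T\<^sup>\<star>) \<xi>) \<xi> = cnj (cinner (T \<xi>) \<xi>)"
      using cinner_adj[of T \<xi> \<xi>] by (metis cinner_commute)
    moreover have "cnj \<alpha> * \<alpha>\<^sup>2 = \<alpha>" using \<alpha>\<alpha> by (simp add: power2_eq_square mult_ac)
    ultimately have "cinner (\<alpha>\<^sup>2 *\<^sub>C (T\<^sup>\<star>) \<xi>) (\<alpha> *\<^sub>C \<xi>) = cnj (cinner (T \<xi>) (\<alpha> *\<^sub>C \<xi>))"
      by (simp add: cinner_scaleC_left cinner_scaleC_right flip: mult.assoc)
    then have "2 * q = Re (cinner ((T + \<alpha>\<^sup>2 *\<^sub>C T\<^sup>\<star>) \<xi>) (\<alpha> *\<^sub>C \<xi>))"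
      by (simp add: q_def bop_apply_add_left bop_apply_scaleC_left cinner_add_left)
    also have "\<dots> \<le> norm ((T + \<alpha>\<^sup>2 *\<^sub>C T\<^sup>\<star>) \<xi>) * norm (\<alpha> *\<^sub>C \<xi>)" by (rule Re_cinner_le)
    also have "\<dots> \<le> norm (T + \<alpha>\<^sup>2 *\<^sub>C T\<^sup>\<star>)"
      using \<xi>(1) \<alpha> norm_bop_unit_le by (simp add: norm_scaleC)
    finally show "2 * norm T \<le> norm (T + \<alpha>\<^sup>2 *\<^sub>C T\<^sup>\<star>) + e" using q by linarith
  qed
  moreover have "norm (T + \<alpha>\<^sup>2 *\<^sub>C T\<^sup>\<star>) \<le> norm T + norm (\<alpha>\<^sup>2 *\<^sub>C T\<^sup>\<star>)"
    by (rule norm_triangle_ineq)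
  ultimately show ?thesis
    using \<alpha> unfolding parallel_def
    by (intro exI[of _ "\<alpha>\<^sup>2"]) (simp add: norm_scaleC norm_adj norm_power)
qed

text \<open>
  Moving \<open>T\<^sup>\<star>\<close> to the other side turns the cross term \<open>Re \<langle>T \<xi>, \<alpha> T\<^sup>\<star> \<xi>\<rangle>\<close> into \<open>Re \<langle>T\<^sup>2 \<xi>, \<alpha> \<xi>\<rangle>\<close>. So the
  approximate eigenvalue is found first for \<open>T\<^sup>2\<close> and then passed to \<open>T\<close> through a square root of \<open>\<alpha>\<close>.
\<close>
lemma approx_eigenvalue_if_parallel_adj:
  fixes T :: "'a::chilbert_space bop"
  assumes nonzero: "\<exists>x::'a. x \<noteq> 0" and par: "T \<parallel> T\<^sup>\<star>"
  shows "\<exists>\<alpha>. cmod \<alpha> = 1 \<and> approx_eigenvalue T (\<alpha> * complex_of_real (norm T))"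
proof -
  obtain \<alpha> where \<alpha>: "cmod \<alpha> = 1" "norm (T + \<alpha> *\<^sub>C T\<^sup>\<star>) = norm T + norm (T\<^sup>\<star>)"
    using par unfolding parallel_def by blast
  have cross: "cinner (T \<xi>) (\<alpha> *\<^sub>C (T\<^sup>\<star>) \<xi>) = cinner ((T ^ 2) \<xi>) (\<alpha> *\<^sub>C \<xi>)" for \<xi>
    by (simp add: power2_eq_square cinner_scaleC_right cinner_adj)
  have "approx_eigenvalue (T ^ 2) (\<alpha> * complex_of_real ((norm T)\<^sup>2))"
    using parallel_cross_term[OF nonzero \<alpha>]
    by (intro approx_eigenvalue_if_numerical \<alpha> norm_bop_power_le)
      (simp add: cross norm_adj power2_eq_square[of "norm T"])
  moreover define \<gamma> where "\<gamma> = csqrt \<alpha>"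
  ultimately have "approx_eigenvalue (T ^ 2) ((\<gamma> * complex_of_real (norm T))\<^sup>2)"
    by (simp add: power_mult_distrib)
  then have "approx_eigenvalue T (\<gamma> * complex_of_real (norm T)) \<or>
      approx_eigenvalue T (- \<gamma> * complex_of_real (norm T))"
    using approx_eigenvalue_square_root by fastforce
  moreover have "cmod \<gamma> = 1" using \<alpha>(1) by (simp add: \<gamma>_def)
  ultimately show ?thesis by (metis norm_minus_cancel)
qed

lemma parallel_one_iff_parallel_adj:
  fixes T :: "'a::chilbert_space bop"
  assumes "\<exists>x::'a. x \<noteq> 0"
  shows "T \<parallel> 1 \<longleftrightarrow> T \<parallel> T\<^sup>\<star>"
  using approx_eigenvalue_if_parallel_adj[OF assms] parallel_adj_if_approx_eigenvalue
    parallel_one_iff_approx_eigenvalue[OF assms] by blast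

text \<open>
  An approximate eigenvalue of \<open>T\<close> of modulus \<open>\<parallel>T\<parallel>\<close> forces \<open>\<parallel>T\<^sup>m\<parallel> = \<parallel>T\<parallel>\<^sup>m\<close>, so that its \<open>m\<close>-th power
  has the modulus \<open>\<parallel>T\<^sup>m\<parallel>\<close> required for \<open>T\<^sup>m\<close>.
\<close>
lemma parallel_one_power:
  fixes T :: "'a::complex_inner bop"
  assumes nonzero: "\<exists>x::'a. x \<noteq> 0" and par: "T \<parallel> 1"
  shows "T ^ m \<parallel> 1"
proof -
  obtain \<alpha> where \<alpha>: "cmod \<alpha> = 1" "approx_eigenvalue T (\<alpha> * complex_of_real (norm T))"
    using par parallel_one_iff_approx_eigenvalue[OF nonzero] by blast
  have ev: "approx_eigenvalue (T ^ m) (\<alpha> ^ m * complex_of_real (norm T ^ m))"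
    using approx_eigenvalue_power[OF \<alpha>(2), of m] by (simp add: power_mult_distrib)
  have "norm T ^ m \<le> norm (T ^ m)"
    using approx_eigenvalue_norm_le[OF ev] \<alpha>(1) by (simp add: norm_mult norm_power)
  then have "norm (T ^ m) = norm T ^ m" using norm_bop_power_le by (rule antisym[rotated])
  then show ?thesis
    using ev \<alpha>(1) by (auto simp: parallel_one_iff_approx_eigenvalue[OF nonzero] norm_power
        intro!: exI[of _ "\<alpha> ^ m"])
qed

theorem theorem3p10:
  fixes T :: "'a::chilbert_space bop"
  assumes nonzero: "\<exists>x::'a. x \<noteq> 0"
  shows "(T \<parallel> 1 \<longleftrightarrow> T \<parallel> T\<^sup>\<star>) \<and>
    (T \<parallel> 1 \<longleftrightarrow>
      (\<exists>(\<xi> :: nat \<Rightarrow> 'a) (\<alpha> :: complex).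
        (\<forall>n. norm (\<xi> n) = 1) \<and> cmod \<alpha> = 1 \<and>
        (\<lambda>n. norm (T (\<xi> n) - (\<alpha> * complex_of_real (norm T)) *\<^sub>C \<xi> n)) \<longlonglongrightarrow> 0)) \<and>
    (T \<parallel> 1 \<longleftrightarrow> (\<forall>m::nat\<ge>1. T ^ m \<parallel> 1)) \<and>
    (T \<parallel> 1 \<longleftrightarrow> (\<forall>m::nat\<ge>1. T ^ m \<parallel> (T\<^sup>\<star>) ^ m))"
proof (intro conjI)
  show "T \<parallel> 1 \<longleftrightarrow> T \<parallel> T\<^sup>\<star>" by (rule parallel_one_iff_parallel_adj[OF nonzero])
  show "T \<parallel> 1 \<longleftrightarrow>
      (\<exists>(\<xi> :: nat \<Rightarrow> 'a) (\<alpha> :: complex).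
        (\<forall>n. norm (\<xi> n) = 1) \<and> cmod \<alpha> = 1 \<and>
        (\<lambda>n. norm (T (\<xi> n) - (\<alpha> * complex_of_real (norm T)) *\<^sub>C \<xi> n)) \<longlonglongrightarrow> 0)"
    unfolding parallel_one_iff_approx_eigenvalue[OF nonzero] approx_eigenvalue_iff_sequence by blast
  show powers: "T \<parallel> 1 \<longleftrightarrow> (\<forall>m::nat\<ge>1. T ^ m \<parallel> 1)"
    using parallel_one_power[OF nonzero] by (metis le_refl power_one_right)
  show "T \<parallel> 1 \<longleftrightarrow> (\<forall>m::nat\<ge>1. T ^ m \<parallel> (T\<^sup>\<star>) ^ m)"
    unfolding powers by (simp add: parallel_one_iff_parallel_adj[OF nonzero] adj_power)
qed

end
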